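(* Let $T:\mathbf{Set}\to\mathbf{Set}$ be a monad with multiplication $\mu$, equipped with a natural transformation $0:\underline{1}\to T$. If $T\emptyset\cong1$, then the axiom $\mathtt{p\,;\,0}=\mathtt{0}$ holds, i.e. for every set $X$ and every map $p:X\to TX$, \[ \mu_X\circ T(0_X\circ!_X)\circ p=0_X\circ!_X . \]
   Context: $\underline{1}$ is the constant functor with value a one-element set $1$, and $!_X:X\to1$ is the unique map. The constant $\mathtt{0}$ is interpreted at $X$ as $0_X\circ!_X:X\to TX$ and $\mathtt{p\,;\,q}$ as the Kleisli composite $\mu_X\circ T[\![\mathtt q]\!]\circ[\![\mathtt p]\!]$. *)

theory Defs
  imports "HOL-Library.FuncSet" "HOL-Library.Equipollence"
begin

text \<open>
  HOL cannot quantify over endofunctors of the category of all types, and its types are nonempty,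
  so \<open>Set\<close> is rendered as the category of sets in a Grothendieck universe. The type \<open>'u\<close> plays the
  role of the universe and \<open>U\<close> is the collection of those subsets of \<open>'u\<close> that are sets (as
  opposed to proper classes). The elements of \<open>'u\<close> are atoms, so closure under power sets is
  expressed up to bijection. The empty set is obtained as a subset of a singleton. As in the usual
  definition of a Grothendieck universe, no infinite member is required; the existence of a
  universe with an infinite member would not be provable in HOL.
\<close>

definition set_universe :: "'u set set \<Rightarrow> bool" where
  "set_universe U \<longleftrightarrow>
     (\<forall>x. {x} \<in> U) \<and>
     (\<forall>A\<in>U. \<forall>B. B \<subseteq> A \<longrightarrow> B \<in> U) \<and>
     (\<forall>A\<in>U. \<exists>P\<in>U. Pow A \<approx> P) \<and>
     (\<forall>I\<in>U. \<forall>F. (\<forall>i\<in>I. F i \<in> U) \<longrightarrow> (\<Union>i\<in>I. F i) \<in> U)"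

lemma set_universe_finite: "set_universe {A :: nat set. finite A}"
proof -
  have "\<exists>P :: nat set. finite P \<and> Pow A \<approx> P" if "finite A" for A :: "nat set"
    using that by (intro exI[of _ "{..<card (Pow A)}"])
      (simp add: eqpoll_iff_card del: card_Pow)
  then show ?thesis
    by (auto simp: set_universe_def intro: finite_subset)
qed

text \<open>
  The morphisms from \<open>X\<close> to \<open>Y\<close> are the extensional functions \<open>X \<rightarrow>\<^sub>E Y\<close>, so that equality of
  morphisms is HOL equality; composition is \<open>compose\<close> and the identity is \<open>\<lambda>x\<in>X. x\<close>. An extensional
  function determines its domain but not its codomain, hence the action of a functor on
  morphisms also takes the source and target objects.
\<close>

record 'u endofunctor =
  ob :: "'u set \<Rightarrow> 'u set"
  arr :: "'u set \<Rightarrow> 'u set \<Rightarrow> ('u \<Rightarrow> 'u) \<Rightarrow> 'u \<Rightarrow> 'u"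

definition is_endofunctor :: "'u set set \<Rightarrow> 'u endofunctor \<Rightarrow> bool" where
  "is_endofunctor U F \<longleftrightarrow>
     (\<forall>X\<in>U. ob F X \<in> U) \<and>
     (\<forall>X\<in>U. \<forall>Y\<in>U. \<forall>f \<in> X \<rightarrow>\<^sub>E Y. arr F X Y f \<in> ob F X \<rightarrow>\<^sub>E ob F Y) \<and>
     (\<forall>X\<in>U. arr F X X (\<lambda>x\<in>X. x) = (\<lambda>t\<in>ob F X. t)) \<and>
     (\<forall>X\<in>U. \<forall>Y\<in>U. \<forall>Z\<in>U. \<forall>f \<in> X \<rightarrow>\<^sub>E Y. \<forall>g \<in> Y \<rightarrow>\<^sub>E Z.
        arr F X Z (compose X g f) = compose (ob F X) (arr F Y Z g) (arr F X Y f))"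

definition id_functor :: "'u endofunctor" where
  "id_functor = \<lparr>ob = (\<lambda>X. X), arr = (\<lambda>X Y f. f)\<rparr>"

definition const_functor :: "'u set \<Rightarrow> 'u endofunctor" where
  "const_functor C = \<lparr>ob = (\<lambda>X. C), arr = (\<lambda>X Y f. \<lambda>c\<in>C. c)\<rparr>"

definition comp_functor :: "'u endofunctor \<Rightarrow> 'u endofunctor \<Rightarrow> 'u endofunctor" where
  "comp_functor G F =
     \<lparr>ob = (\<lambda>X. ob G (ob F X)), arr = (\<lambda>X Y f. arr G (ob F X) (ob F Y) (arr F X Y f))\<rparr>"

definition is_nat_trans ::
  "'u set set \<Rightarrow> 'u endofunctor \<Rightarrow> 'u endofunctor \<Rightarrow> ('u set \<Rightarrow> 'u \<Rightarrow> 'u) \<Rightarrow> bool" where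
  "is_nat_trans U F G \<alpha> \<longleftrightarrow>
     (\<forall>X\<in>U. \<alpha> X \<in> ob F X \<rightarrow>\<^sub>E ob G X) \<and>
     (\<forall>X\<in>U. \<forall>Y\<in>U. \<forall>f \<in> X \<rightarrow>\<^sub>E Y.
        compose (ob F X) (arr G X Y f) (\<alpha> X) = compose (ob F X) (\<alpha> Y) (arr F X Y f))"

definition is_monad ::
  "'u set set \<Rightarrow> 'u endofunctor \<Rightarrow> ('u set \<Rightarrow> 'u \<Rightarrow> 'u) \<Rightarrow> ('u set \<Rightarrow> 'u \<Rightarrow> 'u) \<Rightarrow> bool" where
  "is_monad U T \<eta> \<mu> \<longleftrightarrow>
     is_endofunctor U T \<and>
     is_nat_trans U id_functor T \<eta> \<and>
     is_nat_trans U (comp_functor T T) T \<mu> \<and>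
     (\<forall>X\<in>U. compose (ob T X) (\<mu> X) (\<eta> (ob T X)) = (\<lambda>t\<in>ob T X. t)) \<and>
     (\<forall>X\<in>U. compose (ob T X) (\<mu> X) (arr T X (ob T X) (\<eta> X)) = (\<lambda>t\<in>ob T X. t)) \<and>
     (\<forall>X\<in>U. compose (ob T (ob T (ob T X))) (\<mu> X) (\<mu> (ob T X)) =
        compose (ob T (ob T (ob T X))) (\<mu> X) (arr T (ob T (ob T X)) (ob T X) (\<mu> X)))"

definition bang :: "'u set \<Rightarrow> 'u set \<Rightarrow> 'u \<Rightarrow> 'u" where
  "bang One X = (\<lambda>x\<in>X. the_elem One)"

definition sem_zero :: "'u set \<Rightarrow> ('u set \<Rightarrow> 'u \<Rightarrow> 'u) \<Rightarrow> 'u set \<Rightarrow> 'u \<Rightarrow> 'u" where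
  "sem_zero One zero X = compose X (zero X) (bang One X)"

text \<open>The semantics of \<open>p ; q\<close> at \<open>X\<close>: run \<open>p\<close> first, then \<open>q\<close>.\<close>

definition sem_seq ::
  "'u endofunctor \<Rightarrow> ('u set \<Rightarrow> 'u \<Rightarrow> 'u) \<Rightarrow> 'u set \<Rightarrow> ('u \<Rightarrow> 'u) \<Rightarrow> ('u \<Rightarrow> 'u) \<Rightarrow> 'u \<Rightarrow> 'u" where
  "sem_seq T \<mu> X p q = compose X (compose (ob T X) (\<mu> X) (arr T X (ob T X) q)) p"

end

theory Submission
  imports Defs
begin

text \<open>
  Let \<open>f : \<emptyset> \<rightarrow> X\<close> be the unique map. By naturality of \<open>0\<close>, the map \<open>0\<^sub>X \<circ> !\<^sub>X\<close> factors as
  \<open>T f \<circ> h\<close> with \<open>h = 0\<^sub>\<emptyset> \<circ> ! : X \<rightarrow> T \<emptyset>\<close>. Naturality of \<open>\<mu>\<close> then gives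
  \<open>\<mu>\<^sub>X \<circ> T (0\<^sub>X \<circ> !\<^sub>X) \<circ> p = T f \<circ> (\<mu>\<^sub>\<emptyset> \<circ> T h \<circ> p)\<close>, and the bracketed map is constantly the unique
  element of \<open>T \<emptyset>\<close>, which \<open>T f\<close> sends to \<open>0\<^sub>X\<close>.
\<close>

lemma set_universe_empty:
  assumes "set_universe U"
  shows "{} \<in> U"
  using assms unfolding set_universe_def by blast

lemma is_singleton_eqpoll:
  assumes "A \<approx> B" "is_singleton B"
  shows "is_singleton A"
  using assms by (metis eqpoll_singleton_iff is_singleton_def)

lemma nat_trans_apply:
  assumes "is_nat_trans U F G \<alpha>" "X \<in> U" "Y \<in> U" "f \<in> X \<rightarrow>\<^sub>E Y" "t \<in> ob F X"
  shows "arr G X Y f (\<alpha> X t) = \<alpha> Y (arr F X Y f t)"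
proof -
  have "compose (ob F X) (arr G X Y f) (\<alpha> X) t = compose (ob F X) (\<alpha> Y) (arr F X Y f) t"
    using assms unfolding is_nat_trans_def by metis
  with assms(5) show ?thesis by (simp add: compose_eq)
qed

theorem theorem5p8:
  fixes U :: "'u set set"
    and T :: "'u endofunctor"
    and \<eta> \<mu> zero :: "'u set \<Rightarrow> 'u \<Rightarrow> 'u"
    and One :: "'u set"
  assumes "set_universe U"
    and "is_monad U T \<eta> \<mu>"
    and "is_singleton One"
    and "is_nat_trans U (const_functor One) T zero"
    and "ob T {} \<approx> One"
  shows "\<forall>X\<in>U. \<forall>p \<in> X \<rightarrow>\<^sub>E ob T X.
           sem_seq T \<mu> X p (sem_zero One zero X) = sem_zero One zero X"
proof (intro ballI)
  fix X p assume X: "X \<in> U" and p: "p \<in> X \<rightarrow>\<^sub>E ob T X"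
  obtain c where One: "One = {c}"
    using assms(3) by (auto simp: is_singleton_def)
  have E: "{} \<in> U" using assms(1) by (rule set_universe_empty)
  have endo: "is_endofunctor U T" and nat_\<mu>: "is_nat_trans U (comp_functor T T) T \<mu>"
    using assms(2) by (auto simp: is_monad_def)
  have obT: "ob T Y \<in> U" if "Y \<in> U" for Y
    using endo that by (auto simp: is_endofunctor_def)
  have arrT: "arr T Y Z g \<in> ob T Y \<rightarrow>\<^sub>E ob T Z" if "Y \<in> U" "Z \<in> U" "g \<in> Y \<rightarrow>\<^sub>E Z" for Y Z g
    using endo that by (auto simp: is_endofunctor_def)
  \<comment> \<open>Extensional functions are \<open>undefined\<close> off their domain, so this is
    the only arrow out of the empty set.\<close>
  define f :: "'u \<Rightarrow> 'u" where "f = (\<lambda>_. undefined)"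
  have f: "f \<in> {} \<rightarrow>\<^sub>E X" by (simp add: f_def)
  define e where "e = zero {} c"
  define h where "h = (\<lambda>x\<in>X. e)"
  have "e \<in> ob T {}"
    using assms(4) E One by (auto simp: e_def is_nat_trans_def const_functor_def)
  then have TE: "ob T {} = {e}"
    using is_singleton_eqpoll[OF assms(5,3)] by (auto simp: is_singleton_def)
  have h: "h \<in> X \<rightarrow>\<^sub>E ob T {}" by (simp add: h_def TE)
  \<comment> \<open>Naturality of \<open>zero\<close> at \<open>f\<close>: the constant functor
    turns \<open>f\<close> into the identity, which fixes \<open>c\<close>.\<close>
  have Tf_e: "arr T {} X f e = zero X c"
    using nat_trans_apply[OF assms(4) E X f, of c]
    by (simp add: const_functor_def One e_def)
  have zero_eq: "sem_zero One zero X = compose X (arr T {} X f) h"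
    by (auto simp: sem_zero_def bang_def compose_def h_def One Tf_e intro!: restrict_ext)
  \<comment> \<open>Functoriality of \<open>T\<close>, applied to the factorisation through
    \<open>ob T {}\<close>.\<close>
  have Tzero: "arr T X (ob T X) (sem_zero One zero X) =
      compose (ob T X) (arr T (ob T {}) (ob T X) (arr T {} X f)) (arr T X (ob T {}) h)"
    using endo X obT[OF E] obT[OF X] h arrT[OF E X f]
    unfolding zero_eq is_endofunctor_def by blast
  have "\<mu> X (arr T X (ob T X) (sem_zero One zero X) t) = zero X c" if t: "t \<in> ob T X" for t
  proof -
    define s where "s = arr T X (ob T {}) h t"
    have s: "s \<in> ob T (ob T {})"
      using arrT[OF X obT[OF E] h] t by (auto simp: s_def)
    \<comment> \<open>\<open>\<mu> {}\<close> lands in the singleton \<open>ob T {}\<close>, so the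
      dependence on \<open>t\<close> disappears.\<close>
    then have \<mu>s: "\<mu> {} s = e"
      using nat_\<mu> E TE by (auto simp: is_nat_trans_def comp_functor_def)
    have "\<mu> X (arr T X (ob T X) (sem_zero One zero X) t) =
        \<mu> X (arr T (ob T {}) (ob T X) (arr T {} X f) s)"
      using t by (simp add: Tzero compose_eq s_def)
    also have "\<dots> = arr T {} X f (\<mu> {} s)"
      using nat_trans_apply[OF nat_\<mu> E X f, of s] s by (simp add: comp_functor_def)
    finally show ?thesis by (simp add: \<mu>s Tf_e)
  qed
  \<comment> \<open>The pointwise fact is then used at \<open>t = p x\<close>.\<close>
  moreover have "p x \<in> ob T X" if "x \<in> X" for x
    using p that by auto
  ultimately show "sem_seq T \<mu> X p (sem_zero One zero X) = sem_zero One zero X"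
    unfolding sem_seq_def
    by (auto simp: sem_zero_def bang_def compose_def One intro!: restrict_ext)
qed

end
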